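(* The category $\mathfrak{IR}$ of irreducible finite-dimensional rotational representations of $\mathbb{R}\langle X,Y\rangle$ is classified by the following list of objects (that is, the listed objects belong to $\mathfrak{IR}$, are pairwise non-isomorphic in $\mathfrak{R}$, and every object of $\mathfrak{IR}$ is isomorphic in $\mathfrak{R}$ to one of them): \begin{itemize} \item $(r,s)$, where $r,s\in\{-1,1\}$ (acting on $\mathbb{R}^1$); \item $(r\mathbb{I}_2,R_\beta)$, $(R_\alpha,s\mathbb{I}_2)$, $(R_\alpha,R_{r\beta})$, where $r,s\in\{-1,1\}$ and $\alpha,\beta\in\,]0,\pi[$ (acting on $\mathbb{R}^2$); \item $\left(R_\alpha\oplus R_\alpha,\;T_\theta(R_\beta\oplus R_\beta)T_{-\theta}\right)$, where $\alpha,\beta,\theta\in\,]0,\pi[$ (acting on $\mathbb{R}^4$). \end{itemize}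
   Context: A rotation in a Euclidean space $V=(V,\langle\,,\rangle)$ is an orthogonal endomorphism $\delta\in O(V)$ such that (1) $\delta^2(v)\in\operatorname{span}\{v,\delta(v)\}$ and (2) $\langle v,\delta(v)\rangle=\langle w,\delta(w)\rangle$ for all unit vectors $v,w\in V$. A pair $(\sigma,\tau)$ of linear endomorphisms of a real vector space $V$ is identified with the representation $\mathbb{R}\langle X,Y\rangle\to\operatorname{End}(V)$, $X\mapsto\sigma$, $Y\mapsto\tau$, of the free associative algebra $\mathbb{R}\langle X,Y\rangle$. If $V$ is Euclidean and $\delta,\epsilon$ are rotations in $V$, the representation $(\delta,\epsilon)$ is called rotational. $\mathfrak{R}$ is the category of finite-dimensional rotational representations; a morphism from $(\delta,\epsilon)$ in $V$ to $(\sigma,\tau)$ in $W$ is a linear map $\varphi:V\to W$ with $\varphi\delta=\sigma\varphi$, $\varphi\epsilon=\tau\varphi$ which decomposes as $\varphi=\psi\oplus 0:U\oplus\ker\varphi\to W$, where $U=(\ker\varphi)^\perp\subset V$ and $\psi:U\to W$ is orthogonal (inner product preserving). In particular, isomorphisms in $\mathfrak{R}$ are the orthogonal isomorphisms of representations. $\mathfrak{IR}$ is the full subcategory of $\mathfrak{R}$ of irreducible objects (non-zero, with no proper non-zero subspace invariant under both maps). $\mathbb{R}^n$ is a Euclidean space with the standard scalar product, and linear maps $\mathbb{R}^n\to\mathbb{R}^m$ are identified with $m\times n$ matrices. $\mathbb{I}_n$ is the $n\times n$ identity matrix, $$R_\alpha=\begin{pmatrix}\cos\alpha&-\sin\alpha\\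 \sin\alpha&\cos\alpha\end{pmatrix},$$ $A\oplus B$ denotes the block diagonal matrix with blocks $A,B$, and for $\theta\in\mathbb{R}$, $T_\theta=1\oplus R_\theta\oplus 1\in O_4(\mathbb{R})$, i.e. the block diagonal $4\times4$ matrix with diagonal blocks $1$, $R_\theta$, $1$. *)

theory Defs
  imports "HOL-Analysis.Analysis"
begin

definition rotation_map :: "('a::euclidean_space \<Rightarrow> 'a) \<Rightarrow> bool" where
  "rotation_map \<delta> \<longleftrightarrow>
     orthogonal_transformation \<delta> \<and>
     (\<forall>v. \<delta> (\<delta> v) \<in> span {v, \<delta> v}) \<and>
     (\<forall>v w. norm v = 1 \<longrightarrow> norm w = 1 \<longrightarrow> v \<bullet> \<delta> v = w \<bullet> \<delta> w)"

text \<open>A representation of the free algebra on two generators is given by the images of the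
  generators. The underlying Euclidean space is the whole type \<^typ>\<open>'a\<close>; since types of
  class \<^class>\<open>euclidean_space\<close> have positive dimension, only the zero object is left out,
  and it is not irreducible.\<close>

type_synonym 'a rep = "('a \<Rightarrow> 'a) \<times> ('a \<Rightarrow> 'a)"

definition rotational :: "'a::euclidean_space rep \<Rightarrow> bool" where
  "rotational \<rho> \<longleftrightarrow> rotation_map (fst \<rho>) \<and> rotation_map (snd \<rho>)"

definition irreducible_rep :: "'a::euclidean_space rep \<Rightarrow> bool" where
  "irreducible_rep \<rho> \<longleftrightarrow>
     (UNIV :: 'a set) \<noteq> {0} \<and>
     (\<forall>U. subspace U \<longrightarrow> fst \<rho> ` U \<subseteq> U \<longrightarrow> snd \<rho> ` U \<subseteq> U \<longrightarrow> U = {0} \<or> U = UNIV)"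

definition IR_object :: "'a::euclidean_space rep \<Rightarrow> bool" where
  "IR_object \<rho> \<longleftrightarrow> rotational \<rho> \<and> irreducible_rep \<rho>"

definition R_morphism ::
    "'a::euclidean_space rep \<Rightarrow> 'b::euclidean_space rep \<Rightarrow> ('a \<Rightarrow> 'b) \<Rightarrow> bool" where
  "R_morphism \<rho> \<rho>' \<phi> \<longleftrightarrow>
     linear \<phi> \<and>
     \<phi> \<circ> fst \<rho> = fst \<rho>' \<circ> \<phi> \<and>
     \<phi> \<circ> snd \<rho> = snd \<rho>' \<circ> \<phi> \<and>
     (\<forall>u \<in> orthogonal_comp {x. \<phi> x = 0}. \<forall>v \<in> orthogonal_comp {x. \<phi> x = 0}.
        \<phi> u \<bullet> \<phi> v = u \<bullet> v)"

definition R_isomorphic :: "'a::euclidean_space rep \<Rightarrow> 'b::euclidean_space rep \<Rightarrow> bool" where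
  "R_isomorphic \<rho> \<rho>' \<longleftrightarrow>
     (\<exists>\<phi> \<psi>. R_morphism \<rho> \<rho>' \<phi> \<and> R_morphism \<rho>' \<rho> \<psi> \<and> \<psi> \<circ> \<phi> = id \<and> \<phi> \<circ> \<psi> = id)"

definition matrix_rep :: "real^'n^'n \<Rightarrow> real^'n^'n \<Rightarrow> (real^'n) rep" where
  "matrix_rep A B = ((\<lambda>x. A *v x), (\<lambda>x. B *v x))"

definition R_mat :: "real \<Rightarrow> real^2^2" where
  "R_mat \<alpha> = vector [vector [cos \<alpha>, - sin \<alpha>],
                     vector [sin \<alpha>,   cos \<alpha>]]"

definition block_diag2 :: "real^2^2 \<Rightarrow> real^2^2 \<Rightarrow> real^4^4" where
  "block_diag2 A B = vector [vector [A$1$1, A$1$2, 0, 0],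
                             vector [A$2$1, A$2$2, 0, 0],
                             vector [0, 0, B$1$1, B$1$2],
                             vector [0, 0, B$2$1, B$2$2]]"

definition T_mat :: "real \<Rightarrow> real^4^4" where
  "T_mat \<theta> = vector [vector [1, 0, 0, 0],
                     vector [0, R_mat \<theta> $1$1, R_mat \<theta> $1$2, 0],
                     vector [0, R_mat \<theta> $2$1, R_mat \<theta> $2$2, 0],
                     vector [0, 0, 0, 1]]"

definition labels1 :: "(real \<times> real) set" where
  "labels1 = {-1, 1} \<times> {-1, 1}"

definition obj1 :: "real \<times> real \<Rightarrow> (real^1) rep" where
  "obj1 = (\<lambda>(r, s). matrix_rep (mat r) (mat s))"

datatype label2 = Scalar_Rot real real | Rot_Scalar real real | Rot_Rot real real real

definition labels2 :: "label2 set" where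
  "labels2 =
     {Scalar_Rot r \<beta> | r \<beta>. r \<in> {-1, 1} \<and> \<beta> \<in> {0<..<pi}} \<union>
     {Rot_Scalar \<alpha> s | \<alpha> s. \<alpha> \<in> {0<..<pi} \<and> s \<in> {-1, 1}} \<union>
     {Rot_Rot \<alpha> r \<beta> | \<alpha> r \<beta>. \<alpha> \<in> {0<..<pi} \<and> r \<in> {-1, 1} \<and> \<beta> \<in> {0<..<pi}}"

fun obj2 :: "label2 \<Rightarrow> (real^2) rep" where
  "obj2 (Scalar_Rot r \<beta>) = matrix_rep (r *\<^sub>R mat 1) (R_mat \<beta>)"
| "obj2 (Rot_Scalar \<alpha> s) = matrix_rep (R_mat \<alpha>) (s *\<^sub>R mat 1)"
| "obj2 (Rot_Rot \<alpha> r \<beta>) = matrix_rep (R_mat \<alpha>) (R_mat (r * \<beta>))"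

definition labels4 :: "(real \<times> real \<times> real) set" where
  "labels4 = {0<..<pi} \<times> {0<..<pi} \<times> {0<..<pi}"

definition obj4 :: "real \<times> real \<times> real \<Rightarrow> (real^4) rep" where
  "obj4 = (\<lambda>(\<alpha>, \<beta>, \<theta>).
     matrix_rep (block_diag2 (R_mat \<alpha>) (R_mat \<alpha>))
                (T_mat \<theta> ** block_diag2 (R_mat \<beta>) (R_mat \<beta>) ** T_mat (- \<theta>)))"

end

theory Submission
  imports Defs
begin

text \<open>A rotation has constant angle, so its symmetric part is a scalar \<open>cos \<alpha>\<close>; hence it is
  either \<open>1\<close>, \<open>-1\<close>, or \<open>cos \<alpha> + sin \<alpha> J\<close> for an orthogonal complex structure \<open>J\<close> and
  \<open>0 < \<alpha> < \<pi>\<close>. For a pair of complex structures \<open>J, K\<close> the operator \<open>JK + KJ\<close> is self-adjoint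
  and commutes with both, so on an irreducible representation it is a scalar \<open>-2 cos \<theta>\<close>. If
  \<open>\<theta> \<in> {0, \<pi>}\<close> then \<open>K = \<plusminus>J\<close>, and \<open>v, Jv\<close> spans an invariant plane. Otherwise
  \<open>K = cos \<theta> J + sin \<theta> L\<close> with \<open>L\<close> a complex structure anticommuting with \<open>J\<close>, and
  \<open>v, Jv, Lv, JLv\<close> is an orthonormal basis of an invariant subspace. In each case the matrices
  in that basis are those of the list. Pairwise non-isomorphism follows since the dimension and
  the scalars \<open>\<langle>v, \<delta>v\<rangle>\<close>, \<open>\<langle>v, \<epsilon>v\<rangle>\<close>, \<open>\<langle>\<delta>v, \<epsilon>v\<rangle>\<close>, which do not depend on the unit vector \<open>v\<close>,
  are invariants and recover the parameters.\<close>

subsection \<open>Rotations and complex structures\<close>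

lemma vector_4 [simp]:
  "(vector [x, y, z, w] :: 'a::zero^4) $ 1 = x"
  "(vector [x, y, z, w] :: 'a::zero^4) $ 2 = y"
  "(vector [x, y, z, w] :: 'a::zero^4) $ 3 = z"
  "(vector [x, y, z, w] :: 'a::zero^4) $ 4 = w"
  unfolding vector_def by simp_all

definition complex_structure :: "('a::euclidean_space \<Rightarrow> 'a) \<Rightarrow> bool" where
  "complex_structure J \<longleftrightarrow> orthogonal_transformation J \<and> (\<forall>x. J (J x) = - x)"

text \<open>This is exp(\<alpha>J) when \<open>J\<close> is a complex structure: the coordinate-free
  form of a direct sum of copies of \<open>R_mat \<alpha>\<close>.\<close>

definition rot :: "real \<Rightarrow> ('a::euclidean_space \<Rightarrow> 'a) \<Rightarrow> 'a \<Rightarrow> 'a" where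
  "rot \<alpha> J x = cos \<alpha> *\<^sub>R x + sin \<alpha> *\<^sub>R J x"

lemma complex_structureD:
  assumes "complex_structure J"
  shows "linear J" "J (J x) = - x" "J x \<bullet> J y = x \<bullet> y"
    "J x \<bullet> y = - (x \<bullet> J y)" "x \<bullet> J x = 0" "J x \<bullet> x = 0"
proof -
  show lin: "linear J" and sq: "J (J x) = - x" for x
    using assms by (auto simp: complex_structure_def orthogonal_transformation_def)
  show iso: "J x \<bullet> J y = x \<bullet> y" for x y
    using assms by (auto simp: complex_structure_def orthogonal_transformation_def)
  show skew: "J x \<bullet> y = - (x \<bullet> J y)" for x y
    using iso[of "J x" y] by (simp add: sq)
  show "x \<bullet> J x = 0" "J x \<bullet> x = 0"
    using skew[of x x] by (simp_all add: inner_commute)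
qed

lemma rot_unit:
  assumes "complex_structure J" "norm v = 1"
  shows "v \<bullet> rot \<alpha> J v = cos \<alpha>"
  using assms(2) complex_structureD[OF assms(1)]
  by (simp add: rot_def inner_simps power2_norm_eq_inner[symmetric])

text \<open>Skewness of \<open>J\<close> cancels the cross terms in the inner product. The operator
  satisfies the characteristic equation of \<open>R_mat \<alpha>\<close>, X^2 = 2 cos \<alpha> X -
  1, which gives the span condition.\<close>

lemma rotation_map_rot:
  assumes J: "complex_structure J"
  shows "rotation_map (rot \<alpha> J)"
proof -
  note [simp] = complex_structureD[OF J] linear_add[OF complex_structureD(1)[OF J]]
    linear_scale[OF complex_structureD(1)[OF J]]
  have lin: "linear (rot \<alpha> J)"
    by (rule linearI) (simp_all add: rot_def algebra_simps)
  have iso: "rot \<alpha> J v \<bullet> rot \<alpha> J w = v \<bullet> w" for v w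
  proof -
    have "rot \<alpha> J v \<bullet> rot \<alpha> J w = cos \<alpha> * (cos \<alpha> * (v \<bullet> w)) + sin \<alpha> * (sin \<alpha> * (v \<bullet> w))"
      by (simp add: rot_def inner_simps algebra_simps)
    also have "\<dots> = (cos \<alpha> * cos \<alpha> + sin \<alpha> * sin \<alpha>) * (v \<bullet> w)"
      by (simp only: distrib_right mult.assoc)
    finally show ?thesis by simp
  qed
  have sq: "rot \<alpha> J (rot \<alpha> J v) = (2 * cos \<alpha>) *\<^sub>R rot \<alpha> J v - v" for v
  proof -
    have "rot \<alpha> J (rot \<alpha> J v) - (2 * cos \<alpha>) *\<^sub>R rot \<alpha> J v
        = - ((cos \<alpha> * cos \<alpha>) *\<^sub>R v + (sin \<alpha> * sin \<alpha>) *\<^sub>R v)"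
      unfolding mult_2 scaleR_left_distrib by (simp add: rot_def algebra_simps)
    also have "\<dots> = - v"
      by (simp flip: scaleR_left.add)
    finally show ?thesis by (simp add: algebra_simps)
  qed
  have "rot \<alpha> J (rot \<alpha> J v) \<in> span {v, rot \<alpha> J v}" for v
    unfolding sq by (intro span_diff span_scale span_base) auto
  then show ?thesis
    unfolding rotation_map_def orthogonal_transformation_def
    using lin iso rot_unit[OF J] by auto
qed

lemma sign_scalar_unit:
  "norm v = 1 \<Longrightarrow> v \<bullet> (r *\<^sub>R v) = (r::real)"
  by (simp add: power2_norm_eq_inner[symmetric])

lemma rotation_map_sign:
  assumes "r \<in> {-1, 1::real}"
  shows "rotation_map (\<lambda>x::'a::euclidean_space. r *\<^sub>R x)"
proof -
  have "orthogonal_transformation (\<lambda>x::'a. r *\<^sub>R x)"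
    using assms by (auto simp: orthogonal_transformation_def linear_iff algebra_simps)
  moreover have "r *\<^sub>R (r *\<^sub>R v) \<in> span {v, r *\<^sub>R v}" for v :: 'a
    by (intro span_scale span_base) auto
  ultimately show ?thesis
    unfolding rotation_map_def by (simp del: inner_scaleR_right add: sign_scalar_unit)
qed

text \<open>With c the common value of \<langle>v, \<delta>v\<rangle> on unit vectors, homogeneity
  gives \<langle>v, \<delta>v\<rangle> = c\<langle>v, v\<rangle>. Polarisation turns this into
  \<delta> + \<delta>* = 2c, and Cauchy-Schwarz bounds c.\<close>

lemma rotation_map_skew:
  assumes "rotation_map (\<delta> :: 'a::euclidean_space \<Rightarrow> 'a)"
  obtains c where "\<bar>c\<bar> \<le> 1" "\<And>v w. v \<bullet> \<delta> w + w \<bullet> \<delta> v = 2 * c * (v \<bullet> w)"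
proof -
  have ot: "orthogonal_transformation \<delta>"
    and const: "\<And>v w. norm v = 1 \<Longrightarrow> norm w = 1 \<Longrightarrow> v \<bullet> \<delta> v = w \<bullet> \<delta> w"
    using assms unfolding rotation_map_def by blast+
  have lin: "linear \<delta>" using ot by (simp add: orthogonal_transformation_def)
  obtain u :: 'a where u: "norm u = 1"
    using vector_choose_size[of 1] by auto
  define c where "c = u \<bullet> \<delta> u"
  have "\<bar>c\<bar> \<le> 1"
    using Cauchy_Schwarz_ineq2[of u "\<delta> u"] u ot
    by (simp add: c_def orthogonal_transformation)
  have quad: "v \<bullet> \<delta> v = c * (v \<bullet> v)" for v
  proof (cases "v = 0")
    case False
    have "(v /\<^sub>R norm v) \<bullet> \<delta> (v /\<^sub>R norm v) = c"
      unfolding c_def by (rule const) (use False u in auto)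
    then have "v \<bullet> \<delta> v = c * (norm v)\<^sup>2"
      using False by (simp add: linear_scale[OF lin] field_simps power2_eq_square)
    then show ?thesis by (simp add: power2_norm_eq_inner)
  qed simp
  have "v \<bullet> \<delta> w + w \<bullet> \<delta> v = 2 * c * (v \<bullet> w)" for v w
    using quad[of "v + w"] quad[of v] quad[of w]
    by (simp add: linear_add[OF lin] inner_simps inner_commute[of w v] algebra_simps)
  with \<open>\<bar>c\<bar> \<le> 1\<close> show thesis using that by blast
qed

lemma rotation_map_cases:
  assumes rm: "rotation_map (\<delta> :: 'a::euclidean_space \<Rightarrow> 'a)"
  obtains (sign) r where "r \<in> {-1, 1}" "\<delta> = (\<lambda>x. r *\<^sub>R x)"
  | (rot) \<alpha> J where "\<alpha> \<in> {0<..<pi}" "complex_structure J" "\<delta> = rot \<alpha> J"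
proof -
  obtain c where c: "\<bar>c\<bar> \<le> 1"
    and sym: "\<And>v w. v \<bullet> \<delta> w + w \<bullet> \<delta> v = 2 * c * (v \<bullet> w)"
    using rotation_map_skew[OF rm] by blast
  have lin: "linear \<delta>" and iso: "\<And>v w. \<delta> v \<bullet> \<delta> w = v \<bullet> w"
    using rm by (auto simp: rotation_map_def orthogonal_transformation_def)
  have quad: "v \<bullet> \<delta> v = c * (v \<bullet> v)" for v
    using sym[of v v] by simp
  \<comment> \<open>Since \<delta> is an isometry, \<delta>* is its inverse, so \<delta> + \<delta>*
    = 2c becomes a quadratic equation for \<delta>.\<close>
  have sq: "\<delta> (\<delta> v) = (2 * c) *\<^sub>R \<delta> v - v" for v
  proof -
    have "x \<bullet> \<delta> (\<delta> v) = x \<bullet> ((2 * c) *\<^sub>R \<delta> v - v)" for x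
      using sym[of x "\<delta> v"] iso[of v x] by (simp add: inner_diff_right inner_commute[of v x])
    then show ?thesis using vector_eq_ldot by blast
  qed
  show thesis
  proof (cases "\<bar>c\<bar> = 1")
    case True
    have "(\<delta> v - c *\<^sub>R v) \<bullet> (\<delta> v - c *\<^sub>R v) = (1 - c\<^sup>2) * (v \<bullet> v)" for v
      using quad[of v] iso[of v v]
      by (simp add: inner_simps inner_commute[of "\<delta> v" v] power2_eq_square algebra_simps)
    moreover have "c\<^sup>2 = 1" using True by (simp add: abs_square_eq_1)
    ultimately have "\<delta> v = c *\<^sub>R v" for v by simp
    moreover have "c \<in> {-1, 1}" using True by auto
    ultimately show thesis by (intro sign[of c]) auto
  next
    case False
    define \<alpha> where "\<alpha> = arccos c"
    have \<alpha>: "\<alpha> \<in> {0<..<pi}" "cos \<alpha> = c"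
      using c False arccos_lt_bounded[of c] by (auto simp: \<alpha>_def)
    then have s: "sin \<alpha> > 0" by (simp add: sin_gt_zero)
    have s2: "sin \<alpha> * sin \<alpha> = 1 - c * c"
      using sin_cos_squared_add[of \<alpha>] \<alpha> by (simp add: power2_eq_square)
    \<comment> \<open>The skew part of \<delta>, normalised. Its properties are proved after
      multiplication by sin^2 \<alpha>, which is nonzero.\<close>
    define J where "J x = (\<delta> x - c *\<^sub>R x) /\<^sub>R sin \<alpha>" for x
    have linJ: "linear J"
      by (rule linearI) (simp_all add: J_def linear_add[OF lin] linear_scale[OF lin] algebra_simps)
    have J: "sin \<alpha> *\<^sub>R J x = \<delta> x - c *\<^sub>R x" for x
      using s by (simp add: J_def)
    have "sin \<alpha> *\<^sub>R sin \<alpha> *\<^sub>R J (J x) = - (sin \<alpha> * sin \<alpha>) *\<^sub>R x" for x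
    proof -
      have "sin \<alpha> *\<^sub>R sin \<alpha> *\<^sub>R J (J x) = \<delta> (\<delta> x - c *\<^sub>R x) - c *\<^sub>R (\<delta> x - c *\<^sub>R x)"
        using J[of "sin \<alpha> *\<^sub>R J x"] unfolding linear_scale[OF linJ] by (simp only: J)
      then show ?thesis
        unfolding s2 linear_diff[OF lin] linear_scale[OF lin] sq mult_2 scaleR_left_distrib
        by (simp add: algebra_simps)
    qed
    then have Jsq: "J (J x) = - x" for x
    proof -
      have "(sin \<alpha> * sin \<alpha>) *\<^sub>R J (J x) = (sin \<alpha> * sin \<alpha>) *\<^sub>R (- x)"
        using \<open>sin \<alpha> *\<^sub>R sin \<alpha> *\<^sub>R J (J x) = - (sin \<alpha> * sin \<alpha>) *\<^sub>R x\<close> by simp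
      then show ?thesis using s by (simp add: scaleR_cancel_left del: scaleR_minus_right)
    qed
    have "(sin \<alpha> * sin \<alpha>) * (J x \<bullet> J y) = (sin \<alpha> * sin \<alpha>) * (x \<bullet> y)" for x y
    proof -
      have "(sin \<alpha> * sin \<alpha>) * (J x \<bullet> J y) = (sin \<alpha> *\<^sub>R J x) \<bullet> (sin \<alpha> *\<^sub>R J y)"
        by simp
      also have "\<dots> = (\<delta> x - c *\<^sub>R x) \<bullet> (\<delta> y - c *\<^sub>R y)"
        by (simp only: J)
      \<comment> \<open>By \<open>sym\<close> the mixed terms contribute -2c^2\<langle>x,
        y\<rangle>.\<close>
      also have "\<dots> = (1 - c * c) * (x \<bullet> y)"
        using sym[of x y] iso[of x y]
        by (simp add: inner_simps inner_commute[of "\<delta> x" y] algebra_simps)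
          (simp flip: distrib_left)
      finally show ?thesis by (simp add: s2)
    qed
    then have "J x \<bullet> J y = x \<bullet> y" for x y
      using s by simp
    with linJ Jsq have "complex_structure J"
      by (auto simp: complex_structure_def orthogonal_transformation_def)
    moreover have "\<delta> = rot \<alpha> J"
      using s by (auto simp: rot_def J_def \<alpha>)
    ultimately show thesis using \<alpha> rot by blast
  qed
qed

subsection \<open>Irreducibility and isomorphism\<close>

definition orthonormal :: "('n::finite \<Rightarrow> 'a::euclidean_space) \<Rightarrow> bool" where
  "orthonormal b \<longleftrightarrow> (\<forall>i j. b i \<bullet> b j = (if i = j then 1 else 0))"

lemma orthonormal_span_UNIV:
  fixes b :: "'n::finite \<Rightarrow> 'a::euclidean_space"
  assumes b: "orthonormal b" and card: "CARD('n) = DIM('a)"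
  shows "span (range b) = UNIV"
proof -
  have "inj b"
    using b by (intro injI) (metis orthonormal_def zero_neq_one)
  then have "card (range b) = DIM('a)"
    using card by (simp add: card_image)
  moreover have "independent (range b)"
    using b by (intro pairwise_orthogonal_independent)
      (auto simp: pairwise_def orthogonal_def orthonormal_def, metis inner_zero_left zero_neq_one)
  ultimately show ?thesis
    by (simp add: dim_eq_full[symmetric] dim_eq_card_independent)
qed

text \<open>A nonzero invariant subspace contains a unit vector; if it always contains, with it, an
  orthonormal family as large as the dimension, it is the whole space.\<close>

lemma irreducible_repI:
  fixes \<rho> :: "'a::euclidean_space rep"
  assumes card: "CARD('n::finite) = DIM('a)"
    and fam: "\<And>U v. \<lbrakk>subspace U; fst \<rho> ` U \<subseteq> U; snd \<rho> ` U \<subseteq> U; v \<in> U; norm v = 1\<rbrakk> \<Longrightarrow>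
      \<exists>b::'n \<Rightarrow> 'a. orthonormal b \<and> range b \<subseteq> U"
  shows "irreducible_rep \<rho>"
  unfolding irreducible_rep_def
proof (intro conjI allI impI)
  obtain u :: 'a where "norm u = 1"
    using vector_choose_size[of 1] by auto
  then show "(UNIV :: 'a set) \<noteq> {0}" by (metis UNIV_I norm_zero singletonD zero_neq_one)
next
  fix U :: "'a set"
  assume U: "subspace U" "fst \<rho> ` U \<subseteq> U" "snd \<rho> ` U \<subseteq> U"
  show "U = {0} \<or> U = UNIV"
  proof (cases "U = {0}")
    case False
    then obtain v where v: "v \<in> U" "v \<noteq> 0"
      using subspace_0[OF U(1)] by auto
    then have "v /\<^sub>R norm v \<in> U" "norm (v /\<^sub>R norm v) = 1"
      using U(1) by (auto intro: subspace_scale)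
    then obtain b :: "'n \<Rightarrow> 'a" where "orthonormal b" "range b \<subseteq> U"
      using fam[OF U] by blast
    then have "UNIV \<subseteq> U"
      using orthonormal_span_UNIV[OF _ card] span_minimal U(1) by metis
    then show ?thesis by blast
  qed simp
qed

text \<open>The family \<open>b\<close> is not assumed to span: its span is invariant by the matrix equations,
  so irreducibility does the rest.\<close>

lemma R_isomorphicI:
  fixes \<rho> :: "'a::euclidean_space rep" and A B :: "real^'n^'n"
  assumes \<rho>: "IR_object \<rho>" and b: "orthonormal b"
    and A: "\<And>j. fst \<rho> (b j) = (\<Sum>i\<in>UNIV. A $ i $ j *\<^sub>R b i)"
    and B: "\<And>j. snd \<rho> (b j) = (\<Sum>i\<in>UNIV. B $ i $ j *\<^sub>R b i)"
  shows "R_isomorphic \<rho> (matrix_rep A B)"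
proof -
  define \<psi> where "\<psi> x = (\<Sum>i\<in>UNIV. x $ i *\<^sub>R b i)" for x :: "real^'n"
  have lin\<psi>: "linear \<psi>"
    by (rule linearI) (simp_all add: \<psi>_def algebra_simps sum.distrib scaleR_sum_right)
  have coord: "\<psi> x \<bullet> b i = x $ i" for x i
  proof -
    have "b j \<bullet> b i = (if j = i then 1 else 0)" for j
      using b by (simp add: orthonormal_def)
    then have "\<psi> x \<bullet> b i = (\<Sum>j\<in>UNIV. x $ j * (if j = i then 1 else 0))"
      unfolding \<psi>_def inner_sum_left inner_scaleR_left by (simp only:)
    then show ?thesis by (simp add: if_distrib cong: if_cong)
  qed
  have iso: "\<psi> x \<bullet> \<psi> y = x \<bullet> y" for x y
  proof -
    have "\<psi> x \<bullet> \<psi> y = (\<Sum>i\<in>UNIV. y $ i * (\<psi> x \<bullet> b i))"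
      by (simp add: \<psi>_def[of y] inner_sum_right)
    then show ?thesis by (simp add: coord inner_vec_def mult.commute)
  qed
  \<comment> \<open>The columns of \<open>M\<close> hold the coordinates of the images of the
    family, so \<psi> intertwines \<open>M\<close> with \<delta>.\<close>
  have inter: "\<delta> (\<psi> x) = \<psi> (M *v x)"
    if "linear \<delta>" and M: "\<And>j. \<delta> (b j) = (\<Sum>i\<in>UNIV. M $ i $ j *\<^sub>R b i)" for \<delta> M x
  proof -
    have "\<delta> (\<psi> x) = (\<Sum>j\<in>UNIV. x $ j *\<^sub>R (\<Sum>i\<in>UNIV. M $ i $ j *\<^sub>R b i))"
      by (simp add: \<psi>_def linear_sum[OF that(1)] linear_scale[OF that(1)] M)
    also have "\<dots> = (\<Sum>j\<in>UNIV. \<Sum>i\<in>UNIV. (M $ i $ j * x $ j) *\<^sub>R b i)"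
      by (simp add: scaleR_sum_right mult.commute)
    also have "\<dots> = (\<Sum>i\<in>UNIV. \<Sum>j\<in>UNIV. (M $ i $ j * x $ j) *\<^sub>R b i)"
      by (rule sum.swap)
    also have "\<dots> = \<psi> (M *v x)"
      by (simp add: \<psi>_def matrix_vector_mult_def scaleR_sum_left)
    finally show ?thesis .
  qed
  have lin: "linear (fst \<rho>)" "linear (snd \<rho>)"
    using \<rho> by (auto simp: IR_object_def rotational_def rotation_map_def orthogonal_transformation_def)
  note interA = inter[OF lin(1) A] and interB = inter[OF lin(2) B]
  have "subspace (range \<psi>)"
    using lin\<psi> by (simp add: linear_subspace_image)
  moreover have "fst \<rho> ` range \<psi> \<subseteq> range \<psi>" "snd \<rho> ` range \<psi> \<subseteq> range \<psi>"
    by (auto simp: interA interB)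
  ultimately have "range \<psi> = {0} \<or> range \<psi> = UNIV"
    using \<rho> by (auto simp: IR_object_def irreducible_rep_def)
  moreover have "range \<psi> \<noteq> {0}"
  proof
    assume "range \<psi> = {0}"
    \<comment> \<open>\<open>undefined\<close> stands for an arbitrary index; the all-ones vector
      has coordinate 1 at each of them.\<close>
    then have "\<psi> (\<chi> i. 1) \<bullet> b undefined = 0" by (metis inner_zero_left rangeI singletonD)
    then show False by (simp add: coord)
  qed
  ultimately have "surj \<psi>" by blast
  moreover have "inj \<psi>"
    by (rule injI) (metis coord vec_eq_iff)
  ultimately obtain \<phi> where \<phi>: "\<And>x. \<psi> (\<phi> x) = x" "\<And>x. \<phi> (\<psi> x) = x"
    by (metis inv_f_f surj_f_inv_f)
  have lin\<phi>: "linear \<phi>"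
    by (rule linearI) (metis \<phi> linear_add[OF lin\<psi>], metis \<phi> linear_scale[OF lin\<psi>])
  have iso\<phi>: "\<phi> x \<bullet> \<phi> y = x \<bullet> y" for x y
    by (metis \<phi>(1) iso)
  have "\<phi> (fst \<rho> x) = A *v \<phi> x" "\<phi> (snd \<rho> x) = B *v \<phi> x" for x
    by (metis \<phi> interA, metis \<phi> interB)
  then have "R_morphism \<rho> (matrix_rep A B) \<phi>"
    using lin\<phi> iso\<phi> by (auto simp: R_morphism_def matrix_rep_def)
  moreover have "R_morphism (matrix_rep A B) \<rho> \<psi>"
    using lin\<psi> iso interA interB by (auto simp: R_morphism_def matrix_rep_def)
  ultimately show ?thesis
    unfolding R_isomorphic_def using \<phi> by (intro exI[of _ \<phi>] exI[of _ \<psi>]) auto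
qed

section \<open>Invariants of isomorphism classes\<close>

text \<open>The first two numbers recover \<alpha> and \<beta> up to sign conventions; the third
  sees the relative position of the two rotations, hence the sign \<open>r\<close> in the plane and
  \<theta> in dimension 4.\<close>

definition unit_invariants :: "'a::euclidean_space rep \<Rightarrow> real \<Rightarrow> real \<Rightarrow> real \<Rightarrow> bool" where
  "unit_invariants \<rho> a b d \<longleftrightarrow>
     (\<forall>v. norm v = 1 \<longrightarrow> v \<bullet> fst \<rho> v = a \<and> v \<bullet> snd \<rho> v = b \<and> fst \<rho> v \<bullet> snd \<rho> v = d)"

text \<open>An invertible morphism has kernel {0}, whose orthogonal complement is everything, so the
  partial isometry is an isometry.\<close>

lemma R_isomorphic_isometry:
  assumes "R_isomorphic (\<rho> :: 'a::euclidean_space rep) (\<rho>' :: 'b::euclidean_space rep)"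
  obtains \<phi> where "linear \<phi>" "bij \<phi>" "\<And>x y. \<phi> x \<bullet> \<phi> y = x \<bullet> y"
    "\<And>x. \<phi> (fst \<rho> x) = fst \<rho>' (\<phi> x)" "\<And>x. \<phi> (snd \<rho> x) = snd \<rho>' (\<phi> x)"
proof -
  obtain \<phi> \<psi> where mor: "R_morphism \<rho> \<rho>' \<phi>" and inv: "\<psi> \<circ> \<phi> = id" "\<phi> \<circ> \<psi> = id"
    using assms by (auto simp: R_isomorphic_def)
  have bij: "bij \<phi>" using inv o_bij by blast
  have lin: "linear \<phi>" using mor by (simp add: R_morphism_def)
  have ker: "{x. \<phi> x = 0} = {0}"
    using linear_0[OF lin] bij by (auto simp: bij_def inj_def)
  show thesis
  proof (rule that[OF lin bij])
    show "\<phi> x \<bullet> \<phi> y = x \<bullet> y" for x y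
      using mor unfolding R_morphism_def ker by (simp add: orthogonal_comp_def orthogonal_def)
    show "\<phi> (fst \<rho> x) = fst \<rho>' (\<phi> x)" "\<phi> (snd \<rho> x) = snd \<rho>' (\<phi> x)" for x
      using mor by (auto simp: R_morphism_def fun_eq_iff)
  qed
qed

lemma R_isomorphic_DIM:
  assumes "R_isomorphic (\<rho> :: 'a::euclidean_space rep) (\<rho>' :: 'b::euclidean_space rep)"
  shows "DIM('a) = DIM('b)"
proof -
  obtain \<phi> :: "'a \<Rightarrow> 'b" where "linear \<phi>" "bij \<phi>"
    using R_isomorphic_isometry[OF assms] by metis
  then show ?thesis
    by (metis bij_betw_def dim_UNIV dim_image_eq inj_on_subset top_greatest)
qed

lemma R_isomorphic_unit_invariants:
  assumes iso: "R_isomorphic (\<rho> :: 'a::euclidean_space rep) (\<rho>' :: 'b::euclidean_space rep)"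
    and inv: "unit_invariants \<rho> a b d" "unit_invariants \<rho>' a' b' d'"
  shows "a = a'" "b = b'" "d = d'"
proof -
  obtain \<phi> :: "'a \<Rightarrow> 'b" where \<phi>: "\<And>x y. \<phi> x \<bullet> \<phi> y = x \<bullet> y"
    "\<And>x. \<phi> (fst \<rho> x) = fst \<rho>' (\<phi> x)" "\<And>x. \<phi> (snd \<rho> x) = snd \<rho>' (\<phi> x)"
    using R_isomorphic_isometry[OF iso] by metis
  obtain u :: 'a where u: "norm u = 1"
    using vector_choose_size[of 1] by auto
  then have "norm (\<phi> u) = 1" by (simp add: norm_eq_sqrt_inner \<phi>)
  with u inv show "a = a'" "b = b'" "d = d'"
    unfolding unit_invariants_def by (metis \<phi>)+
qed

subsection \<open>Pairs of complex structures\<close>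

text \<open>The quadratic form \<langle>x, Sx\<rangle> attains its maximum on the compact unit
  sphere, and a maximiser is an eigenvector for the maximal value.\<close>

lemma self_adjoint_eigenvector:
  fixes S :: "'a::euclidean_space \<Rightarrow> 'a"
  assumes lin: "linear S" and adj: "\<And>x y. S x \<bullet> y = x \<bullet> S y"
  obtains m v where "norm v = 1" "S v = m *\<^sub>R v"
proof -
  have "continuous_on (sphere 0 1) (\<lambda>x. x \<bullet> S x)"
    using lin by (intro continuous_intros linear_continuous_on) (simp add: linear_conv_bounded_linear)
  moreover have "sphere (0::'a) 1 \<noteq> {}"
    by simp
  ultimately obtain v where v: "norm v = 1" and max: "\<And>x. norm x = 1 \<Longrightarrow> x \<bullet> S x \<le> v \<bullet> S v"
    using continuous_attains_sup[of "sphere (0::'a) 1" "\<lambda>x. x \<bullet> S x"] by auto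
  define m where "m = v \<bullet> S v"
  \<comment> \<open>\<open>T = m - S\<close> is positive semidefinite with \<open>\<langle>v, Tv\<rangle> = 0\<close>, which forces \<open>Tv = 0\<close>.\<close>
  define T where "T x = m *\<^sub>R x - S x" for x
  have linT: "linear T"
    by (rule linearI) (simp_all add: T_def linear_add[OF lin] linear_scale[OF lin] algebra_simps)
  have T_adj: "T x \<bullet> y = x \<bullet> T y" for x y
    by (simp add: T_def inner_diff_left inner_diff_right adj)
  have T_nonneg: "0 \<le> x \<bullet> T x" for x
  proof (cases "x = 0")
    case False
    have "(x /\<^sub>R norm x) \<bullet> S (x /\<^sub>R norm x) \<le> m"
      unfolding m_def using False by (intro max) simp
    then have "x \<bullet> S x \<le> m * (norm x)\<^sup>2"
      using False by (simp add: linear_scale[OF lin] field_simps power2_eq_square)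
    then show ?thesis
      by (simp add: T_def inner_diff_right power2_norm_eq_inner)
  qed simp
  have "v \<bullet> v = 1" using v by (simp add: norm_eq_1)
  then have vTv: "v \<bullet> T v = 0"
    by (simp add: T_def inner_diff_right m_def)
  define w where "w = T v"
  have adjT: "v \<bullet> T w = w \<bullet> w"
    by (simp only: w_def T_adj)
  \<comment> \<open>Positivity of \<open>T\<close> along the line v + tw. The constant term
    vanishes, so a nonzero linear coefficient would force negative values near t = 0.\<close>
  have expand: "0 \<le> 2 * t * (w \<bullet> w) + t\<^sup>2 * (w \<bullet> T w)" for t
  proof -
    have "T (v + t *\<^sub>R w) = w + t *\<^sub>R T w"
      by (simp only: w_def linear_add[OF linT] linear_scale[OF linT])
    then show ?thesis
      using T_nonneg[of "v + t *\<^sub>R w"] vTv adjT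
      by (simp add: inner_add_left inner_add_right w_def[symmetric] power2_eq_square algebra_simps)
  qed
  have "w \<bullet> w = 0"
  proof (rule ccontr)
    assume "w \<bullet> w \<noteq> 0"
    then have pos: "0 < w \<bullet> w" by simp
    have le: "2 * (w \<bullet> w) \<le> t * (w \<bullet> T w)" if "0 < t" for t
      using expand[of "- t"] that
      by (simp add: power2_eq_square mult.assoc mult.left_commute[of 2] zero_le_mult_iff
          flip: right_diff_distrib)
    have z: "0 \<le> w \<bullet> T w" by (rule T_nonneg)
    \<comment> \<open>The choice t = \<langle>w, w\<rangle> / (\<langle>w, Tw\<rangle> + 1) makes
      the right side less than \<langle>w, w\<rangle>; the 1 keeps the denominator positive.\<close>
    have "2 * (w \<bullet> w) \<le> w \<bullet> w * ((w \<bullet> T w) / (w \<bullet> T w + 1))"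
      using le[of "w \<bullet> w / (w \<bullet> T w + 1)"] pos z by simp
    also have "\<dots> \<le> w \<bullet> w * 1"
      using pos z by (intro mult_left_mono) simp_all
    finally show False using pos by simp
  qed
  then have "S v = m *\<^sub>R v" by (simp add: w_def T_def)
  with v show thesis by (rule that)
qed

text \<open>A Schur argument: an eigenspace of JK + KJ is nonzero and invariant under
  \<open>J\<close> and \<open>K\<close>, hence everything. The eigenvalue is -2\<langle>Jv,
  Kv\<rangle> for any unit vector v, so Cauchy-Schwarz lets it be written as -2 cos
  \<theta>.\<close>

lemma complex_structure_pair_angle:
  fixes J K :: "'a::euclidean_space \<Rightarrow> 'a"
  assumes J: "complex_structure J" and K: "complex_structure K"
    and irr: "\<And>U. \<lbrakk>subspace U; J ` U \<subseteq> U; K ` U \<subseteq> U\<rbrakk> \<Longrightarrow> U = {0} \<or> U = UNIV"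
  obtains \<theta> where "\<theta> \<in> {0..pi}" "\<And>x. J (K x) + K (J x) = - (2 * cos \<theta>) *\<^sub>R x"
    "\<And>x. J x \<bullet> K x = cos \<theta> * (x \<bullet> x)"
proof -
  note lin = complex_structureD(1)[OF J] complex_structureD(1)[OF K]
  note [simp] = complex_structureD(2)[OF J] complex_structureD(2)[OF K]
    linear_add[OF lin(1)] linear_add[OF lin(2)] linear_scale[OF lin(1)] linear_scale[OF lin(2)]
    linear_neg[OF lin(1)] linear_neg[OF lin(2)]
  note skew = complex_structureD(4)[OF J] complex_structureD(4)[OF K]
  define S where "S x = J (K x) + K (J x)" for x
  have "linear S"
    by (rule linearI) (simp_all add: S_def algebra_simps)
  moreover have "S x \<bullet> y = x \<bullet> S y" for x y
    by (simp add: S_def inner_add_left inner_add_right skew)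
  ultimately obtain m v where v: "norm v = 1" "S v = m *\<^sub>R v"
    using self_adjoint_eigenvector by blast
  \<comment> \<open>Both sides expand to JKJ - K in the first case and to KJK - J in the second,
    because J^2 = K^2 = -1.\<close>
  have S_comm: "S (J x) = J (S x)" "S (K x) = K (S x)" for x
    by (simp_all add: S_def)
  define U where "U = {x. S x = m *\<^sub>R x}"
  have "subspace U"
    using \<open>linear S\<close> by (auto simp: subspace_def U_def linear_0 linear_add linear_scale algebra_simps)
  moreover have "J ` U \<subseteq> U" "K ` U \<subseteq> U"
    by (auto simp: U_def S_comm)
  moreover have "v \<in> U" "v \<noteq> 0"
    using v by (auto simp: U_def)
  ultimately have "U = UNIV" using irr by blast
  then have Sm: "S x = m *\<^sub>R x" for x by (auto simp: U_def)
  have JK: "J x \<bullet> K x = - (m / 2) * (x \<bullet> x)" for x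
  proof -
    have "x \<bullet> S x = - 2 * (J x \<bullet> K x)"
      using skew(1)[of x "K x"] skew(2)[of x "J x"]
      by (simp add: S_def inner_add_right inner_commute[of "K x" "J x"])
    then show ?thesis by (simp add: Sm)
  qed
  have "norm (J v) = 1" "norm (K v) = 1"
    using v complex_structureD(3)[OF J, of v v] complex_structureD(3)[OF K, of v v]
    by (simp_all add: norm_eq_sqrt_inner)
  then have "\<bar>J v \<bullet> K v\<bar> \<le> 1"
    using Cauchy_Schwarz_ineq2[of "J v" "K v"] by simp
  moreover have "v \<bullet> v = 1" using v by (simp add: norm_eq_1)
  ultimately have "\<bar>- (m / 2)\<bar> \<le> 1" using JK[of v] by simp
  then have bounds: "- 1 \<le> - (m / 2)" "- (m / 2) \<le> 1" by linarith+
  define \<theta> where "\<theta> = arccos (- (m / 2))"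
  have c: "cos \<theta> = - (m / 2)"
    unfolding \<theta>_def by (rule cos_arccos[OF bounds])
  show thesis
  proof (rule that)
    show "\<theta> \<in> {0..pi}"
      using arccos_bounded[OF bounds] by (simp add: \<theta>_def)
    show "J (K x) + K (J x) = - (2 * cos \<theta>) *\<^sub>R x" for x
      using Sm[of x] by (simp add: S_def c)
    show "J x \<bullet> K x = cos \<theta> * (x \<bullet> x)" for x
      using JK[of x] by (simp only: c)
  qed
qed

section \<open>Anticommuting complex structures and quaternionic frames\<close>

text \<open>For anticommuting \<open>J\<close> and \<open>L\<close> this runs through a great circle
  of unit imaginary quaternions, at angle \<theta> from \<open>J\<close>.\<close>

definition mix :: "real \<Rightarrow> ('a::euclidean_space \<Rightarrow> 'a) \<Rightarrow> ('a \<Rightarrow> 'a) \<Rightarrow> 'a \<Rightarrow> 'a" where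
  "mix \<theta> J L x = cos \<theta> *\<^sub>R J x + sin \<theta> *\<^sub>R L x"

text \<open>Moving \<open>J\<close> across, anticommuting, and moving \<open>L\<close> back shows
  that the number equals its own negative.\<close>

lemma anticommuting_inner:
  assumes J: "complex_structure J" and L: "complex_structure L"
    and anti: "\<And>x. L (J x) = - J (L x)"
  shows "J x \<bullet> L x = 0"
proof -
  have "J x \<bullet> L x = - (x \<bullet> J (L x))" by (rule complex_structureD(4)[OF J])
  also have "\<dots> = x \<bullet> L (J x)" by (simp add: anti)
  also have "\<dots> = - (L x \<bullet> J x)" using complex_structureD(4)[OF L, of x "J x"] by simp
  finally show ?thesis by (simp add: inner_commute)
qed

text \<open>The frame is the orbit of v under 1, i, j, k. Skewness and isometry reduce its inner
  products to \<langle>v, v\<rangle>, \<langle>v, Jv\<rangle>, \<langle>v, Lv\<rangle> and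
  \<langle>Jv, Lv\<rangle>.\<close>

lemma quaternion_orthonormal:
  fixes J L :: "'a::euclidean_space \<Rightarrow> 'a"
  assumes J: "complex_structure J" and L: "complex_structure L"
    and anti: "\<And>x. L (J x) = - J (L x)" and v: "norm v = 1"
  shows "orthonormal (($) (vector [v, J v, L v, J (L v)] :: 'a^4))"
proof -
  have "v \<bullet> v = 1" using v by (simp add: norm_eq_1)
  moreover have "J v \<bullet> L v = 0" "L v \<bullet> J v = 0"
    using anticommuting_inner[OF J L anti, of v] by (simp_all add: inner_commute)
  moreover have "v \<bullet> J (L v) = 0" "J (L v) \<bullet> v = 0"
    using complex_structureD(4)[OF J, of v "L v"] calculation(2) by (simp_all add: inner_commute)
  ultimately show ?thesis
    unfolding orthonormal_def forall_4
    by (simp add: complex_structureD(3,5,6)[OF J] complex_structureD(3,5,6)[OF L])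
qed

lemma complex_orthonormal:
  fixes J :: "'a::euclidean_space \<Rightarrow> 'a"
  assumes J: "complex_structure J" and v: "norm v = 1"
  shows "orthonormal (($) (vector [v, J v] :: 'a^2))"
proof -
  have "v \<bullet> v = 1" using v by (simp add: norm_eq_1)
  then show ?thesis
    unfolding orthonormal_def forall_2 by (simp add: complex_structureD(3,5,6)[OF J])
qed

text \<open>In the square the mixed term sin \<theta> cos \<theta> (JL + LJ) vanishes. A skew
  operator with square -1 is an isometry.\<close>

lemma complex_structure_mix:
  assumes J: "complex_structure J" and L: "complex_structure L"
    and anti: "\<And>x. L (J x) = - J (L x)"
  shows "complex_structure (mix \<theta> J L)"
proof -
  note lin = complex_structureD(1)[OF J] complex_structureD(1)[OF L]
  note [simp] = complex_structureD(2)[OF J] complex_structureD(2)[OF L]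
    linear_add[OF lin(1)] linear_add[OF lin(2)] linear_scale[OF lin(1)] linear_scale[OF lin(2)]
  let ?K = "mix \<theta> J L"
  have lin: "linear ?K"
    by (rule linearI) (simp_all add: mix_def algebra_simps)
  have sq: "?K (?K x) = - x" for x
  proof -
    have "?K (?K x) = - ((cos \<theta> * cos \<theta>) *\<^sub>R x + (sin \<theta> * sin \<theta>) *\<^sub>R x)"
      by (simp add: mix_def anti algebra_simps)
    then show ?thesis by (simp flip: scaleR_left.add)
  qed
  have skew: "?K x \<bullet> y = - (x \<bullet> ?K y)" for x y
    by (simp add: mix_def inner_add_left inner_add_right
        complex_structureD(4)[OF J] complex_structureD(4)[OF L])
  have "?K x \<bullet> ?K y = x \<bullet> y" for x y
    using skew[of x "?K y"] by (simp add: sq)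
  with lin sq show ?thesis
    by (auto simp: complex_structure_def orthogonal_transformation_def)
qed

text \<open>\<open>L\<close> is the part of \<open>K\<close> orthogonal to \<open>J\<close>,
  normalised as in Gram-Schmidt. The hypothesis on JK + KJ says exactly that K - cos \<theta> J
  anticommutes with \<open>J\<close>.\<close>

lemma complex_structure_unmix:
  assumes J: "complex_structure J" and K: "complex_structure K"
    and \<theta>: "\<theta> \<in> {0<..<pi}" and JK: "\<And>x. J (K x) + K (J x) = - (2 * cos \<theta>) *\<^sub>R x"
  obtains L where "complex_structure L" "\<And>x. L (J x) = - J (L x)" "K = mix \<theta> J L"
proof -
  have s: "sin \<theta> > 0" using \<theta> by (simp add: sin_gt_zero)
  have s2: "sin \<theta> * sin \<theta> = 1 - cos \<theta> * cos \<theta>"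
    using sin_cos_squared_add3[of \<theta>] by linarith
  note linJK = complex_structureD(1)[OF J] complex_structureD(1)[OF K]
  note [simp] = complex_structureD(2)[OF J] complex_structureD(2)[OF K]
    linear_add[OF linJK(1)] linear_add[OF linJK(2)] linear_scale[OF linJK(1)]
    linear_scale[OF linJK(2)] linear_diff[OF linJK(1)] linear_diff[OF linJK(2)]
  define L where "L x = (K x - cos \<theta> *\<^sub>R J x) /\<^sub>R sin \<theta>" for x
  have sL: "sin \<theta> *\<^sub>R L x = K x - cos \<theta> *\<^sub>R J x" for x
    using s by (simp add: L_def)
  have lin: "linear L"
    by (rule linearI) (simp_all add: L_def algebra_simps)
  \<comment> \<open>A rewrite rule bringing every product to the order JK; the cosine term is
    written twice so that it cancels without a factor 2.\<close>
  have KJ: "K (J x) = - J (K x) - cos \<theta> *\<^sub>R x - cos \<theta> *\<^sub>R x" for x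
  proof -
    have "- (2 * cos \<theta>) *\<^sub>R x = - cos \<theta> *\<^sub>R x - cos \<theta> *\<^sub>R x"
      unfolding mult_2 minus_add_distrib scaleR_left_distrib by simp
    then show ?thesis using JK[of x] by (simp add: algebra_simps eq_neg_iff_add_eq_0)
  qed
  have "sin \<theta> *\<^sub>R L (J x) = sin \<theta> *\<^sub>R (- J (L x))" for x
  proof -
    have "sin \<theta> *\<^sub>R J (L x) = J (K x - cos \<theta> *\<^sub>R J x)"
      by (simp only: linear_scale[OF linJK(1), symmetric] sL)
    then show ?thesis by (simp add: sL KJ)
  qed
  then have anti: "L (J x) = - J (L x)" for x
    using s by (metis less_irrefl scaleR_cancel_left)
  have "(sin \<theta> * sin \<theta>) *\<^sub>R L (L x) = (sin \<theta> * sin \<theta>) *\<^sub>R (- x)" for x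
  proof -
    have "(sin \<theta> * sin \<theta>) *\<^sub>R L (L x) = sin \<theta> *\<^sub>R L (sin \<theta> *\<^sub>R L x)"
      by (simp add: linear_scale[OF lin])
    also have "\<dots> = K (K x - cos \<theta> *\<^sub>R J x) - cos \<theta> *\<^sub>R J (K x - cos \<theta> *\<^sub>R J x)"
      by (simp only: sL)
    also have "\<dots> = (sin \<theta> * sin \<theta>) *\<^sub>R (- x)"
      unfolding s2 by (simp add: KJ algebra_simps)
    finally show ?thesis .
  qed
  then have sq: "L (L x) = - x" for x
    using s by (metis less_irrefl mult_eq_0_iff scaleR_cancel_left)
  have skew: "L x \<bullet> y = - (x \<bullet> L y)" for x y
    by (simp add: L_def inner_diff_left inner_diff_right algebra_simps
        complex_structureD(4)[OF J] complex_structureD(4)[OF K])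
  have "L x \<bullet> L y = x \<bullet> y" for x y
    using skew[of x "L y"] by (simp add: sq)
  with lin sq have "complex_structure L"
    by (auto simp: complex_structure_def orthogonal_transformation_def)
  moreover have "K = mix \<theta> J L"
    by (auto simp: mix_def sL)
  ultimately show thesis using anti that by blast
qed

section \<open>Invariant subspaces and irreducibility criteria\<close>

lemma invariant_rot:
  assumes "subspace U" "J ` U \<subseteq> U"
  shows "rot \<alpha> J ` U \<subseteq> U"
  using assms by (auto simp: rot_def image_subset_iff intro: subspace_add subspace_scale)

text \<open>\<open>J\<close> is a linear combination of the rotation and the identity as soon as sin
  \<alpha> can be divided by.\<close>

lemma invariant_of_rot:
  assumes U: "subspace U" and inv: "rot \<alpha> J ` U \<subseteq> U" and \<alpha>: "sin \<alpha> \<noteq> 0"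
  shows "J ` U \<subseteq> U"
proof
  fix y assume "y \<in> J ` U"
  then obtain x where x: "x \<in> U" "y = J x" by blast
  have "(rot \<alpha> J x - cos \<alpha> *\<^sub>R x) /\<^sub>R sin \<alpha> \<in> U"
    using inv x by (intro subspace_scale subspace_diff U) auto
  then show "y \<in> U" using \<alpha> x by (simp add: rot_def)
qed

lemma invariant_of_mix:
  assumes U: "subspace U" and inv: "J ` U \<subseteq> U" "mix \<theta> J L ` U \<subseteq> U" and \<theta>: "sin \<theta> \<noteq> 0"
  shows "L ` U \<subseteq> U"
proof
  fix y assume "y \<in> L ` U"
  then obtain x where x: "x \<in> U" "y = L x" by blast
  have "(mix \<theta> J L x - cos \<theta> *\<^sub>R J x) /\<^sub>R sin \<theta> \<in> U"
    using inv x by (intro subspace_scale subspace_diff U) auto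
  then show "y \<in> U" using \<theta> x by (simp add: mix_def)
qed

text \<open>Here c is the cosine of the angle between \<open>J\<close> and \<open>K\<close>: it is 1
  if they coincide and cos \<theta> for \<open>mix\<close>. The terms \<langle>v, Kv\<rangle> and
  \<langle>Jv, v\<rangle> vanish.\<close>

lemma unit_invariants_rot:
  assumes J: "complex_structure J" and K: "complex_structure K"
    and JK: "\<And>x. J x \<bullet> K x = c * (x \<bullet> x)"
  shows "unit_invariants (rot \<alpha> J, rot \<beta> K) (cos \<alpha>) (cos \<beta>)
    (cos \<alpha> * cos \<beta> + sin \<alpha> * sin \<beta> * c)"
  unfolding unit_invariants_def fst_conv snd_conv
proof (intro allI impI conjI)
  fix v :: 'a assume v: "norm v = 1"
  then have "v \<bullet> v = 1" by (simp add: norm_eq_1)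
  then show "rot \<alpha> J v \<bullet> rot \<beta> K v = cos \<alpha> * cos \<beta> + sin \<alpha> * sin \<beta> * c"
    by (simp add: rot_def inner_add_left inner_add_right JK complex_structureD(5)[OF K]
        complex_structureD(6)[OF J])
qed (simp_all add: rot_unit J K)

lemma unit_invariants_sign_rot:
  assumes K: "complex_structure K"
  shows "unit_invariants ((\<lambda>x. r *\<^sub>R x), rot \<beta> K) r (cos \<beta>) (r * cos \<beta>)"
  by (simp add: unit_invariants_def rot_unit[OF K] norm_eq_1)

lemma unit_invariants_rot_sign:
  assumes J: "complex_structure J"
  shows "unit_invariants (rot \<alpha> J, (\<lambda>x. s *\<^sub>R x)) (cos \<alpha>) s (s * cos \<alpha>)"
  by (simp add: unit_invariants_def rot_unit[OF J] norm_eq_1 inner_commute[of "rot \<alpha> J _"])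

lemma irreducible_one_dim:
  assumes "DIM('a::euclidean_space) = 1"
  shows "irreducible_rep (\<rho> :: 'a rep)"
proof (rule irreducible_repI[where 'n = 1])
  fix U and v :: 'a assume "v \<in> U" "norm v = 1"
  then show "\<exists>b :: 1 \<Rightarrow> 'a. orthonormal b \<and> range b \<subseteq> U"
    by (intro exI[of _ "\<lambda>_. v"]) (auto simp: orthonormal_def norm_eq_1)
qed (simp add: assms)

text \<open>In the plane v and Jv already span. The hypothesis \<open>inv\<close> allows either
  generator to supply \<open>J\<close>, so all planar families are covered at once.\<close>

lemma irreducible_complex_structure:
  fixes J :: "'a::euclidean_space \<Rightarrow> 'a"
  assumes J: "complex_structure J" and dim: "DIM('a) = 2"
    and inv: "\<And>U. \<lbrakk>subspace U; fst \<rho> ` U \<subseteq> U; snd \<rho> ` U \<subseteq> U\<rbrakk> \<Longrightarrow> J ` U \<subseteq> U"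
  shows "irreducible_rep \<rho>"
proof (rule irreducible_repI[where 'n = 2])
  fix U and v :: 'a
  assume U: "subspace U" "fst \<rho> ` U \<subseteq> U" "snd \<rho> ` U \<subseteq> U" and v: "v \<in> U" "norm v = 1"
  have "\<forall>i. (vector [v, J v] :: 'a^2) $ i \<in> U"
    unfolding forall_2 using v inv[OF U] by auto
  then show "\<exists>b :: 2 \<Rightarrow> 'a. orthonormal b \<and> range b \<subseteq> U"
    using complex_orthonormal[OF J v(2)] by blast
qed (simp add: dim)

text \<open>The nonzero sines recover \<open>J\<close>, then \<open>mix \<theta> J L\<close>, then
  \<open>L\<close> from the generators, so an invariant subspace contains a full quaternionic
  frame.\<close>

lemma irreducible_quaternion:
  fixes J L :: "'a::euclidean_space \<Rightarrow> 'a"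
  assumes J: "complex_structure J" and L: "complex_structure L"
    and anti: "\<And>x. L (J x) = - J (L x)" and dim: "DIM('a) = 4"
    and \<alpha>: "sin \<alpha> \<noteq> 0" and \<beta>: "sin \<beta> \<noteq> 0" and \<theta>: "sin \<theta> \<noteq> 0"
  shows "irreducible_rep (rot \<alpha> J, rot \<beta> (mix \<theta> J L))"
proof (rule irreducible_repI[where 'n = 4])
  fix U and v :: 'a
  assume U: "subspace U" "fst (rot \<alpha> J, rot \<beta> (mix \<theta> J L)) ` U \<subseteq> U"
    "snd (rot \<alpha> J, rot \<beta> (mix \<theta> J L)) ` U \<subseteq> U" and v: "v \<in> U" "norm v = 1"
  have invJ: "J ` U \<subseteq> U"
    using invariant_of_rot[OF U(1) _ \<alpha>] U(2) by simp
  have "mix \<theta> J L ` U \<subseteq> U"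
    using invariant_of_rot[OF U(1) _ \<beta>] U(3) by simp
  then have invL: "L ` U \<subseteq> U"
    using invariant_of_mix[OF U(1) invJ _ \<theta>] by simp
  have "\<forall>i. (vector [v, J v, L v, J (L v)] :: 'a^4) $ i \<in> U"
    unfolding forall_4 using v invJ invL by auto
  then show "\<exists>b :: 4 \<Rightarrow> 'a. orthonormal b \<and> range b \<subseteq> U"
    using quaternion_orthonormal[OF J L anti v(2)] by blast
qed (simp add: dim)

subsection \<open>The listed objects\<close>

definition J2 :: "real^2 \<Rightarrow> real^2" where
  "J2 x = vector [- x $ 2, x $ 1]"

text \<open>With the standard basis read as 1, i, j, k, \<open>J4\<close> and \<open>L4\<close> are
  left multiplication by i and j. Thus the frame of the first basis vector is the standard basis
  itself.\<close>

definition J4 :: "real^4 \<Rightarrow> real^4" where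
  "J4 x = vector [- x $ 2, x $ 1, - x $ 4, x $ 3]"

definition L4 :: "real^4 \<Rightarrow> real^4" where
  "L4 x = vector [- x $ 3, x $ 4, x $ 1, - x $ 2]"

lemma complex_structure_J2: "complex_structure J2"
  unfolding complex_structure_def orthogonal_transformation_def linear_iff
  by (simp add: J2_def vec_eq_iff forall_2 inner_vec_def sum_2)

lemma complex_structure_J4: "complex_structure J4"
  unfolding complex_structure_def orthogonal_transformation_def linear_iff
  by (simp add: J4_def vec_eq_iff forall_4 inner_vec_def sum_4)

lemma complex_structure_L4: "complex_structure L4"
  unfolding complex_structure_def orthogonal_transformation_def linear_iff
  by (simp add: L4_def vec_eq_iff forall_4 inner_vec_def sum_4)

lemma L4_J4: "L4 (J4 x) = - J4 (L4 x)"
  by (simp add: J4_def L4_def vec_eq_iff forall_4)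

lemma R_mat_mult_vec: "(*v) (R_mat \<alpha>) = rot \<alpha> J2"
  by (simp add: fun_eq_iff R_mat_def rot_def J2_def vec_eq_iff forall_2 matrix_vector_mult_def sum_2)

lemma block_R_mat_mult_vec: "(*v) (block_diag2 (R_mat \<alpha>) (R_mat \<alpha>)) = rot \<alpha> J4"
  by (simp add: fun_eq_iff R_mat_def block_diag2_def rot_def J4_def vec_eq_iff forall_4
      matrix_vector_mult_def sum_4)

text \<open>The entries are made explicit because they are needed both to identify the operator and
  to compare columns in \<open>classify_quaternion\<close>.\<close>

lemma T_conj_block_R_mat:
  "T_mat \<theta> ** block_diag2 (R_mat \<beta>) (R_mat \<beta>) ** T_mat (- \<theta>) =
    vector [vector [cos \<beta>, - sin \<beta> * cos \<theta>, - sin \<beta> * sin \<theta>, 0],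
            vector [sin \<beta> * cos \<theta>, cos \<beta>, 0, sin \<beta> * sin \<theta>],
            vector [sin \<beta> * sin \<theta>, 0, cos \<beta>, - sin \<beta> * cos \<theta>],
            vector [0, - sin \<beta> * sin \<theta>, sin \<beta> * cos \<theta>, cos \<beta>]]"
proof -
  have sc: "cos \<beta> * (cos \<theta> * cos \<theta>) + cos \<beta> * (sin \<theta> * sin \<theta>) = cos \<beta>"
    by (simp flip: distrib_left)
  show ?thesis
    unfolding vec_eq_iff forall_4
    by (simp add: R_mat_def block_diag2_def T_mat_def matrix_matrix_mult_def sum_4 sc
        mult.commute mult.left_commute add.commute)
qed

text \<open>Conjugation by \<open>T_mat \<theta>\<close> turns \<open>J4\<close> into cos \<theta>
  \<open>J4\<close> + sin \<theta> \<open>L4\<close>; this identifies the matrix parameter \<theta>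
  with the angle between the two complex structures.\<close>

lemma T_conj_mult_vec:
  "(*v) (T_mat \<theta> ** block_diag2 (R_mat \<beta>) (R_mat \<beta>) ** T_mat (- \<theta>)) = rot \<beta> (mix \<theta> J4 L4)"
  unfolding T_conj_block_R_mat
  by (simp add: fun_eq_iff rot_def mix_def J4_def L4_def vec_eq_iff forall_4
      matrix_vector_mult_def sum_4 algebra_simps)

lemma scaled_mat_mult_vec: "(*v) (r *\<^sub>R mat 1 :: real^'n^'n) = (\<lambda>x. r *\<^sub>R x)"
  by (simp add: fun_eq_iff scaleR_matrix_vector_assoc[symmetric])

lemma mat_eq_scaleR: "(mat r :: real^'n^'n) = r *\<^sub>R mat 1"
  by (simp add: mat_def vec_eq_iff)

lemma obj1_eq: "obj1 (r, s) = ((\<lambda>x. r *\<^sub>R x), (\<lambda>x. s *\<^sub>R x))"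
  by (simp add: obj1_def matrix_rep_def mat_eq_scaleR[of r] mat_eq_scaleR[of s] scaled_mat_mult_vec)

lemma obj2_eq:
  "obj2 (Scalar_Rot r \<beta>) = ((\<lambda>x. r *\<^sub>R x), rot \<beta> J2)"
  "obj2 (Rot_Scalar \<alpha> s) = (rot \<alpha> J2, (\<lambda>x. s *\<^sub>R x))"
  "obj2 (Rot_Rot \<alpha> r \<beta>) = (rot \<alpha> J2, rot (r * \<beta>) J2)"
  by (simp_all add: matrix_rep_def scaled_mat_mult_vec R_mat_mult_vec)

lemma obj4_eq: "obj4 (\<alpha>, \<beta>, \<theta>) = (rot \<alpha> J4, rot \<beta> (mix \<theta> J4 L4))"
  by (simp add: obj4_def matrix_rep_def T_conj_mult_vec block_R_mat_mult_vec)

lemma sin_neq_0: "\<alpha> \<in> {0<..<pi} \<Longrightarrow> sin \<alpha> \<noteq> 0"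
  using sin_gt_zero[of \<alpha>] by auto

lemma label2_cases:
  assumes "p \<in> labels2"
  obtains r \<beta> where "p = Scalar_Rot r \<beta>" "r \<in> {-1, 1}" "\<beta> \<in> {0<..<pi}"
  | \<alpha> s where "p = Rot_Scalar \<alpha> s" "\<alpha> \<in> {0<..<pi}" "s \<in> {-1, 1}"
  | \<alpha> r \<beta> where "p = Rot_Rot \<alpha> r \<beta>" "\<alpha> \<in> {0<..<pi}" "r \<in> {-1, 1}" "\<beta> \<in> {0<..<pi}"
  using assms unfolding labels2_def by blast

lemma obj1_IR_object: "p \<in> labels1 \<Longrightarrow> IR_object (obj1 p)"
  unfolding labels1_def
  by (cases p) (simp only: mem_Times_iff fst_conv snd_conv obj1_eq IR_object_def rotational_def
      rotation_map_sign irreducible_one_dim DIM_cart DIM_real card_num1 mult_1 simp_thms)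

lemma obj2_IR_object:
  assumes "p \<in> labels2"
  shows "IR_object (obj2 p)"
  using assms
proof (cases p rule: label2_cases)
  case (1 r \<beta>)
  then have "irreducible_rep (obj2 p)"
    by (intro irreducible_complex_structure[OF complex_structure_J2])
      (simp_all add: obj2_eq invariant_of_rot sin_neq_0 del: obj2.simps)
  with 1 show ?thesis
    by (simp add: IR_object_def rotational_def obj2_eq rotation_map_rot complex_structure_J2
        rotation_map_sign del: obj2.simps)
next
  case (2 \<alpha> s)
  then have "irreducible_rep (obj2 p)"
    by (intro irreducible_complex_structure[OF complex_structure_J2])
      (simp_all add: obj2_eq invariant_of_rot sin_neq_0 del: obj2.simps)
  with 2 show ?thesis
    by (simp add: IR_object_def rotational_def obj2_eq rotation_map_rot complex_structure_J2
        rotation_map_sign del: obj2.simps)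
next
  case (3 \<alpha> r \<beta>)
  then have "irreducible_rep (obj2 p)"
    by (intro irreducible_complex_structure[OF complex_structure_J2])
      (simp_all add: obj2_eq invariant_of_rot sin_neq_0 del: obj2.simps)
  with 3 show ?thesis
    by (simp add: IR_object_def rotational_def obj2_eq rotation_map_rot complex_structure_J2
        del: obj2.simps)
qed

lemma obj4_IR_object:
  assumes "p \<in> labels4"
  shows "IR_object (obj4 p)"
proof -
  obtain \<alpha> \<beta> \<theta> where p: "p = (\<alpha>, \<beta>, \<theta>)"
    and range: "\<alpha> \<in> {0<..<pi}" "\<beta> \<in> {0<..<pi}" "\<theta> \<in> {0<..<pi}"
    using assms unfolding labels4_def by blast
  have "irreducible_rep (obj4 p)"
    unfolding p obj4_eq
    using range by (intro irreducible_quaternion complex_structure_J4 complex_structure_L4 L4_J4 sin_neq_0)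
      simp_all
  then show ?thesis
    by (simp add: p IR_object_def rotational_def obj4_eq rotation_map_rot complex_structure_J4
        complex_structure_mix[OF complex_structure_J4 complex_structure_L4 L4_J4])
qed

section \<open>Pairwise non-isomorphism of the listed objects\<close>

lemma unit_invariants_obj1: "unit_invariants (obj1 (r, s)) r s (r * s)"
  by (simp add: obj1_eq unit_invariants_def norm_eq_1)

text \<open>The factor \<open>* 1\<close> is the constant c of \<open>unit_invariants_rot\<close>,
  equal to 1 since both rotations come from \<open>J2\<close>.\<close>

lemma unit_invariants_obj2:
  "unit_invariants (obj2 (Scalar_Rot r \<beta>)) r (cos \<beta>) (r * cos \<beta>)"
  "unit_invariants (obj2 (Rot_Scalar \<alpha> s)) (cos \<alpha>) s (s * cos \<alpha>)"
  "unit_invariants (obj2 (Rot_Rot \<alpha> r \<beta>)) (cos \<alpha>) (cos (r * \<beta>))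
     (cos \<alpha> * cos (r * \<beta>) + sin \<alpha> * sin (r * \<beta>) * 1)"
  unfolding obj2_eq
  by (intro unit_invariants_sign_rot unit_invariants_rot_sign unit_invariants_rot
      complex_structure_J2; simp add: complex_structureD[OF complex_structure_J2])+

lemma unit_invariants_obj4:
  "unit_invariants (obj4 (\<alpha>, \<beta>, \<theta>)) (cos \<alpha>) (cos \<beta>)
     (cos \<alpha> * cos \<beta> + sin \<alpha> * sin \<beta> * cos \<theta>)"
  unfolding obj4_eq
proof (rule unit_invariants_rot)
  show "J4 x \<bullet> mix \<theta> J4 L4 x = cos \<theta> * (x \<bullet> x)" for x
    by (simp add: mix_def inner_add_right complex_structureD(3)[OF complex_structure_J4]
        anticommuting_inner[OF complex_structure_J4 complex_structure_L4 L4_J4])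
qed (intro complex_structure_J4 complex_structure_mix complex_structure_L4 L4_J4)+

lemma cos_inj_open: "\<lbrakk>cos x = cos y; x \<in> {0<..<pi}; y \<in> {0<..<pi}\<rbrakk> \<Longrightarrow> x = y"
  by (simp add: cos_inj_pi)

text \<open>On [0, pi] the cosine reaches 1 and -1 only at the endpoints. This separates scalar
  generators from proper rotations.\<close>

lemma cos_neq_sign: "\<lbrakk>x \<in> {0<..<pi}; r \<in> {-1, 1}\<rbrakk> \<Longrightarrow> cos x \<noteq> r"
  using cos_inj_pi[of x 0] cos_inj_pi[of x pi] by auto

lemma sign_mult_trig:
  assumes "r \<in> {-1, 1::real}"
  shows "cos (r * \<beta>) = cos \<beta>" "sin (r * \<beta>) = r * sin \<beta>"
  using assms by auto

lemma obj1_iso_imp_eq: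
  assumes "R_isomorphic (obj1 p) (obj1 q)"
  shows "p = q"
  using R_isomorphic_unit_invariants[OF assms, of "fst p" "snd p" _ "fst q" "snd q"]
    unit_invariants_obj1[of "fst p" "snd p"] unit_invariants_obj1[of "fst q" "snd q"]
  by (simp add: prod_eq_iff)

lemma obj2_iso_imp_eq:
  assumes iso: "R_isomorphic (obj2 p) (obj2 q)" and p: "p \<in> labels2" and q: "q \<in> labels2"
  shows "p = q"
  using p
proof (cases p rule: label2_cases)
  case p: (1 r \<beta>)
  note inv = R_isomorphic_unit_invariants[OF iso[unfolded p(1)] unit_invariants_obj2(1)]
  from q show ?thesis
  proof (cases q rule: label2_cases)
    case (1 r' \<beta>')
    then show ?thesis
      using inv(1,2)[OF unit_invariants_obj2(1)[of r' \<beta>', folded 1(1)]] p cos_inj_open by auto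
  next
    case (2 \<alpha>' s')
    then show ?thesis
      using inv(1)[OF unit_invariants_obj2(2)[of \<alpha>' s', folded 2(1)]] p cos_neq_sign by metis
  next
    case (3 \<alpha>' r' \<beta>')
    then show ?thesis
      using inv(1)[OF unit_invariants_obj2(3)[of \<alpha>' r' \<beta>', folded 3(1)]] p cos_neq_sign by metis
  qed
next
  case p: (2 \<alpha> s)
  note inv = R_isomorphic_unit_invariants[OF iso[unfolded p(1)] unit_invariants_obj2(2)]
  from q show ?thesis
  proof (cases q rule: label2_cases)
    case (1 r' \<beta>')
    then show ?thesis
      using inv(1)[OF unit_invariants_obj2(1)[of r' \<beta>', folded 1(1)]] p cos_neq_sign by metis
  next
    case (2 \<alpha>' s')
    then show ?thesis
      using inv(1,2)[OF unit_invariants_obj2(2)[of \<alpha>' s', folded 2(1)]] p cos_inj_open by auto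
  next
    case (3 \<alpha>' r' \<beta>')
    then show ?thesis
      using inv(2)[OF unit_invariants_obj2(3)[of \<alpha>' r' \<beta>', folded 3(1)]] p
        sign_mult_trig(1)[of r' \<beta>'] cos_neq_sign by metis
  qed
next
  case p: (3 \<alpha> r \<beta>)
  note inv = R_isomorphic_unit_invariants[OF iso[unfolded p(1)] unit_invariants_obj2(3)]
  from q show ?thesis
  proof (cases q rule: label2_cases)
    case (1 r' \<beta>')
    then show ?thesis
      using inv(1)[OF unit_invariants_obj2(1)[of r' \<beta>', folded 1(1)]] p cos_neq_sign by metis
  next
    case (2 \<alpha>' s')
    then show ?thesis
      using inv(2)[OF unit_invariants_obj2(2)[of \<alpha>' s', folded 2(1)]] p
        sign_mult_trig(1)[of r \<beta>] cos_neq_sign by metis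
  next
    case q: (3 \<alpha>' r' \<beta>')
    note inv' = inv[OF unit_invariants_obj2(3)[of \<alpha>' r' \<beta>', folded q(1)]]
    have \<alpha>: "\<alpha> = \<alpha>'" using inv'(1) p q cos_inj_open by blast
    have \<beta>: "\<beta> = \<beta>'"
      using inv'(2) p q cos_inj_open by (simp add: sign_mult_trig(1))
    \<comment> \<open>The cosine is even and misses the sign; the third invariant contains r sin
      \<alpha> sin \<beta>, whose sines are nonzero.\<close>
    have "r = r'"
      using inv'(3) p q \<alpha> \<beta> sin_neq_0[of \<alpha>] sin_neq_0[of \<beta>]
      by (simp only: sign_mult_trig) simp
    with \<alpha> \<beta> show ?thesis by (simp add: p(1) q(1))
  qed
qed

lemma obj4_iso_imp_eq:
  assumes iso: "R_isomorphic (obj4 p) (obj4 q)" and p: "p \<in> labels4" and q: "q \<in> labels4"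
  shows "p = q"
proof -
  obtain \<alpha> \<beta> \<theta> where p: "p = (\<alpha>, \<beta>, \<theta>)"
    and range: "\<alpha> \<in> {0<..<pi}" "\<beta> \<in> {0<..<pi}" "\<theta> \<in> {0<..<pi}"
    using p unfolding labels4_def by blast
  obtain \<alpha>' \<beta>' \<theta>' where q: "q = (\<alpha>', \<beta>', \<theta>')"
    and range': "\<alpha>' \<in> {0<..<pi}" "\<beta>' \<in> {0<..<pi}" "\<theta>' \<in> {0<..<pi}"
    using q unfolding labels4_def by blast
  note inv = R_isomorphic_unit_invariants[OF iso[unfolded p q] unit_invariants_obj4 unit_invariants_obj4]
  have \<alpha>: "\<alpha> = \<alpha>'" and \<beta>: "\<beta> = \<beta>'"
    using inv(1,2) range range' cos_inj_open by blast+
  \<comment> \<open>For fixed \<alpha> and \<beta> the third invariant is affine in cos \<theta>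
    with nonzero slope sin \<alpha> sin \<beta>.\<close>
  have "cos \<theta> = cos \<theta>'"
    using inv(3) \<alpha> \<beta> sin_neq_0[OF range(1)] sin_neq_0[OF range(2)] by simp
  then have "\<theta> = \<theta>'" using range range' cos_inj_open by blast
  with \<alpha> \<beta> show ?thesis by (simp add: p q)
qed

subsection \<open>Classification\<close>

text \<open>A subspace invariant under \<open>J\<close> and \<open>K\<close> is invariant under the
  rotations built from them, so irreducibility passes to the pair of complex structures.\<close>

lemma irreducible_complex_structures:
  assumes "IR_object (\<rho> :: 'a::euclidean_space rep)"
    and "fst \<rho> = rot \<alpha> J" "snd \<rho> = rot \<beta> K"
    and "subspace U" "J ` U \<subseteq> U" "K ` U \<subseteq> U"
  shows "U = {0} \<or> U = UNIV"
  using assms invariant_rot[of U J \<alpha>] invariant_rot[of U K \<beta>]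
  unfolding IR_object_def irreducible_rep_def by metis

text \<open>Every line is invariant under scalars, so a single unit vector serves as the
  family.\<close>

lemma classify_sign_sign:
  assumes \<rho>: "IR_object (\<rho> :: 'a::euclidean_space rep)"
    and "fst \<rho> = (\<lambda>x. r *\<^sub>R x)" "snd \<rho> = (\<lambda>x. s *\<^sub>R x)"
  shows "R_isomorphic \<rho> (obj1 (r, s))"
proof -
  obtain v :: 'a where v: "norm v = 1"
    using vector_choose_size[of 1] by auto
  show ?thesis
    unfolding obj1_def prod.case
    by (rule R_isomorphicI[OF \<rho>, where b = "\<lambda>_. v"])
      (use v assms in \<open>auto simp: orthonormal_def norm_eq_1 mat_def\<close>)
qed

text \<open>Arbitrary coefficients treat all planar families together; a scalar generator has zero
  coefficient at \<open>J\<close>.\<close>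

lemma classify_complex:
  assumes \<rho>: "IR_object (\<rho> :: 'a::euclidean_space rep)" and J: "complex_structure J"
    and fst: "\<And>x. fst \<rho> x = a *\<^sub>R x + b *\<^sub>R J x"
    and snd: "\<And>x. snd \<rho> x = c *\<^sub>R x + d *\<^sub>R J x"
  shows "R_isomorphic \<rho> (matrix_rep (vector [vector [a, - b], vector [b, a]] :: real^2^2)
    (vector [vector [c, - d], vector [d, c]]))"
proof -
  obtain v :: 'a where v: "norm v = 1"
    using vector_choose_size[of 1] by auto
  show ?thesis
    by (rule R_isomorphicI[OF \<rho> complex_orthonormal[OF J v]];
        rule forall_2[THEN iffD2, rule_format];
        simp add: fst snd sum_2 complex_structureD(2)[OF J])
qed

text \<open>The entry \<open>- 0\<close> matches the matrix shape of \<open>classify_complex\<close>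
  with vanishing \<open>J\<close>-coefficient.\<close>

lemma scaled_mat_2: "r *\<^sub>R mat 1 = (vector [vector [r, - 0], vector [0, r]] :: real^2^2)"
  by (simp add: vec_eq_iff forall_2 mat_def)

lemma classify_quaternion:
  assumes \<rho>: "IR_object (\<rho> :: 'a::euclidean_space rep)"
    and J: "complex_structure J" and L: "complex_structure L"
    and anti: "\<And>x. L (J x) = - J (L x)"
    and fst: "fst \<rho> = rot \<alpha> J" and snd: "snd \<rho> = rot \<beta> (mix \<theta> J L)"
  shows "R_isomorphic \<rho> (obj4 (\<alpha>, \<beta>, \<theta>))"
proof -
  obtain v :: 'a where v: "norm v = 1"
    using vector_choose_size[of 1] by auto
  note [simp] = complex_structureD(2)[OF J] complex_structureD(2)[OF L] anti
    linear_neg[OF complex_structureD(1)[OF J]] linear_neg[OF complex_structureD(1)[OF L]]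
  show ?thesis
    unfolding obj4_def prod.case T_conj_block_R_mat
    by (rule R_isomorphicI[OF \<rho> quaternion_orthonormal[OF J L anti v]];
        rule forall_4[THEN iffD2, rule_format];
        simp add: fst snd sum_4 rot_def mix_def block_diag2_def R_mat_def algebra_simps)
qed

lemma classification:
  assumes \<rho>: "IR_object (\<rho> :: 'a::euclidean_space rep)"
  shows "(\<exists>p\<in>labels1. R_isomorphic \<rho> (obj1 p)) \<or>
    (\<exists>p\<in>labels2. R_isomorphic \<rho> (obj2 p)) \<or>
    (\<exists>p\<in>labels4. R_isomorphic \<rho> (obj4 p))"
proof -
  have rots: "rotation_map (fst \<rho>)" "rotation_map (snd \<rho>)"
    using \<rho> by (auto simp: IR_object_def rotational_def)
  from rots(1) show ?thesis
  proof (cases rule: rotation_map_cases)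
    case r: (sign r)
    from rots(2) show ?thesis
    proof (cases rule: rotation_map_cases)
      case s: (sign s)
      have "(r, s) \<in> labels1" using r s by (auto simp: labels1_def)
      then show ?thesis using classify_sign_sign[OF \<rho> r(2) s(2)] by blast
    next
      case K: (rot \<beta> K)
      have "R_isomorphic \<rho> (obj2 (Scalar_Rot r \<beta>))"
        unfolding obj2.simps scaled_mat_2 R_mat_def
        by (rule classify_complex[OF \<rho> K(2)]) (simp_all add: r K rot_def)
      moreover have "Scalar_Rot r \<beta> \<in> labels2"
        using r K by (auto simp: labels2_def)
      ultimately show ?thesis by blast
    qed
  next
    case J: (rot \<alpha> J)
    from rots(2) show ?thesis
    proof (cases rule: rotation_map_cases)
      case s: (sign s)
      have "R_isomorphic \<rho> (obj2 (Rot_Scalar \<alpha> s))"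
        unfolding obj2.simps scaled_mat_2 R_mat_def
        by (rule classify_complex[OF \<rho> J(2)]) (simp_all add: s J rot_def)
      moreover have "Rot_Scalar \<alpha> s \<in> labels2"
        using s J by (auto simp: labels2_def)
      ultimately show ?thesis by blast
    next
      case K: (rot \<beta> K)
      obtain \<theta> where \<theta>: "\<theta> \<in> {0..pi}" and anti: "\<And>x. J (K x) + K (J x) = - (2 * cos \<theta>) *\<^sub>R x"
        and angle: "\<And>x. J x \<bullet> K x = cos \<theta> * (x \<bullet> x)"
        using complex_structure_pair_angle[OF J(2) K(2)]
          irreducible_complex_structures[OF \<rho> J(3) K(3)] by metis
      show ?thesis
      proof (cases "\<theta> \<in> {0<..<pi}")
        case True
        obtain L where L: "complex_structure L" "\<And>x. L (J x) = - J (L x)" "K = mix \<theta> J L"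
          using complex_structure_unmix[OF J(2) K(2) True anti] by metis
        have "R_isomorphic \<rho> (obj4 (\<alpha>, \<beta>, \<theta>))"
          using classify_quaternion[OF \<rho> J(2) L(1,2) J(3)] K(3) L(3) by simp
        moreover have "(\<alpha>, \<beta>, \<theta>) \<in> labels4"
          using J(1) K(1) True by (simp add: labels4_def)
        ultimately show ?thesis by blast
      next
        case False
        then have "\<theta> = 0 \<or> \<theta> = pi" using \<theta> by auto
        then obtain r :: real where r: "r \<in> {-1, 1}" "cos \<theta> = r" by auto
        \<comment> \<open>At the boundary angles Cauchy-Schwarz is an equality, which makes Kx a
          multiple of Jx.\<close>
        have "K x = r *\<^sub>R J x" for x
        proof -
          have "(K x - r *\<^sub>R J x) \<bullet> (K x - r *\<^sub>R J x) = (1 - r * r) * (x \<bullet> x)"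
            using angle[of x] complex_structureD(3)[OF J(2), of x x] complex_structureD(3)[OF K(2), of x x]
            by (simp add: inner_diff_left inner_diff_right inner_commute[of "K x" "J x"] r(2) algebra_simps)
          moreover have "r * r = 1" using r(1) by auto
          ultimately show ?thesis by simp
        qed
        \<comment> \<open>The sign moves from the complex structure into the angle: rotating by
          \<beta> along rJ is rotating by r\<beta> along \<open>J\<close>.\<close>
        then have "R_isomorphic \<rho> (obj2 (Rot_Rot \<alpha> r \<beta>))"
          unfolding obj2.simps R_mat_def
          by (intro classify_complex[OF \<rho> J(2)]) (simp_all only: J(3) K(3) rot_def sign_mult_trig[OF r(1)]
              scaleR_scaleR mult.commute[of "sin \<beta>" r])
        moreover have "Rot_Rot \<alpha> r \<beta> \<in> labels2"
          using r J K by (auto simp: labels2_def)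
        ultimately show ?thesis by blast
      qed
    qed
  qed
qed

theorem proposition1p3:
  shows
    "(\<forall>p\<in>labels1. IR_object (obj1 p)) \<and>
     (\<forall>p\<in>labels2. IR_object (obj2 p)) \<and>
     (\<forall>p\<in>labels4. IR_object (obj4 p)) \<and>
     (\<forall>p\<in>labels1. \<forall>q\<in>labels1. p \<noteq> q \<longrightarrow> \<not> R_isomorphic (obj1 p) (obj1 q)) \<and>
     (\<forall>p\<in>labels2. \<forall>q\<in>labels2. p \<noteq> q \<longrightarrow> \<not> R_isomorphic (obj2 p) (obj2 q)) \<and>
     (\<forall>p\<in>labels4. \<forall>q\<in>labels4. p \<noteq> q \<longrightarrow> \<not> R_isomorphic (obj4 p) (obj4 q)) \<and>
     (\<forall>p\<in>labels1. \<forall>q\<in>labels2. \<not> R_isomorphic (obj1 p) (obj2 q)) \<and>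
     (\<forall>p\<in>labels1. \<forall>q\<in>labels4. \<not> R_isomorphic (obj1 p) (obj4 q)) \<and>
     (\<forall>p\<in>labels2. \<forall>q\<in>labels4. \<not> R_isomorphic (obj2 p) (obj4 q)) \<and>
     (\<forall>\<rho> :: 'a::euclidean_space rep. IR_object \<rho> \<longrightarrow>
        (\<exists>p\<in>labels1. R_isomorphic \<rho> (obj1 p)) \<or>
        (\<exists>p\<in>labels2. R_isomorphic \<rho> (obj2 p)) \<or>
        (\<exists>p\<in>labels4. R_isomorphic \<rho> (obj4 p)))"
proof (intro conjI ballI allI impI)
  \<comment> \<open>Objects from different lists have different dimensions: 1, 2 or 4.\<close>
  show "\<not> R_isomorphic (obj1 p) (obj2 q)" for p q
    using R_isomorphic_DIM[of "obj1 p" "obj2 q"] by auto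
  show "\<not> R_isomorphic (obj1 p) (obj4 q)" for p q
    using R_isomorphic_DIM[of "obj1 p" "obj4 q"] by auto
  show "\<not> R_isomorphic (obj2 p) (obj4 q)" for p q
    using R_isomorphic_DIM[of "obj2 p" "obj4 q"] by auto
qed (use obj1_IR_object obj2_IR_object obj4_IR_object obj1_iso_imp_eq obj2_iso_imp_eq
    obj4_iso_imp_eq classification in blast)+

end
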